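(* Let $q\ge 4$ be a fixed even integer. For even positive integers $n$, the minimum redundancy $r_{\rm CPB}(n,q)$ of charge and polarity balanced codes of length $n$ over ${\cal A}_q$ satisfies $$r_{\rm CPB}(n,q)=n-\log_q M_{\rm CPB}(n,q)\approx \log_q n+\log_q\left(\pi\sqrt{\frac{q^2-4}{48}}\right),$$ where $\approx$ means that the difference of the two sides tends to $0$ as $n\to\infty$ through even integers.
   Context: For an integer $q\ge 2$, ${\cal A}_q=\{-q+1,-q+3,-q+5,\ldots,q-3,q-1\}$. A sequence ${\bf x}=(x_1,\ldots,x_n)\in({\cal A}_q)^n$ is charge-balanced (CB) if $\sum_{i=1}^n x_i=0$, polarity-balanced (PB) if $|\{i:x_i>0\}|=|\{i:x_i<0\}|$, and charge and polarity balanced (CPB) if it is both CB and PB. $M_{\rm CPB}(n,q)$ is the number of CPB sequences in $({\cal A}_q)^n$. A code of length $n$ is a set of sequences of length $n$; it is CPB if all its codewords are CPB. The redundancy of a $q$-ary code of length $n$ and size $M$ is $n-\log_q M$, and $r_{\rm CPB}(n,q)$ is the minimum redundancy among (nonempty) CPB codes of length $n$ over ${\cal A}_q$. *)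

theory Defs
  imports Complex_Main
begin

definition alphabet :: "nat \<Rightarrow> int set" where
  "alphabet q = (\<lambda>k. 2 * int k - int q + 1) ` {..<q}"

definition words :: "nat \<Rightarrow> nat \<Rightarrow> int list set" where
  "words n q = {xs. length xs = n \<and> set xs \<subseteq> alphabet q}"

definition charge_balanced :: "int list \<Rightarrow> bool" where
  "charge_balanced xs \<longleftrightarrow> (\<Sum>i<length xs. xs ! i) = 0"

definition polarity_balanced :: "int list \<Rightarrow> bool" where
  "polarity_balanced xs \<longleftrightarrow>
     card {i. i < length xs \<and> xs ! i > 0} = card {i. i < length xs \<and> xs ! i < 0}"

definition cpb :: "int list \<Rightarrow> bool" where
  "cpb xs \<longleftrightarrow> charge_balanced xs \<and> polarity_balanced xs"

definition M_CPB :: "nat \<Rightarrow> nat \<Rightarrow> nat" where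
  "M_CPB n q = card {xs \<in> words n q. cpb xs}"

definition cpb_code :: "nat \<Rightarrow> nat \<Rightarrow> int list set \<Rightarrow> bool" where
  "cpb_code n q C \<longleftrightarrow> C \<subseteq> words n q \<and> (\<forall>xs\<in>C. cpb xs)"

definition redundancy :: "nat \<Rightarrow> nat \<Rightarrow> int list set \<Rightarrow> real" where
  "redundancy n q C = real n - log (real q) (real (card C))"

text \<open>There are only finitely many codes of length \<open>n\<close>, so \<open>Min\<close> is a genuine minimum as soon as
  a CPB sequence exists; for even \<open>q \<ge> 2\<close> this is the case exactly when \<open>n\<close> is even.\<close>

definition r_CPB :: "nat \<Rightarrow> nat \<Rightarrow> real" where
  "r_CPB n q = Min {redundancy n q C | C. cpb_code n q C \<and> C \<noteq> {}}"

end

theory Submission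
  imports Defs "HOL-Probability.Distributions" "HOL-Real_Asymp.Real_Asymp"
begin

text \<open>A letter of the alphabet of even size \<open>q = 2m\<close> is uniquely \<open>m e + y\<close> with a sign
  \<open>e \<in> {-1, 1}\<close> and a letter \<open>y\<close> of the alphabet of size \<open>m\<close>, and a word is polarity-balanced
  exactly if its signs sum to 0. Hence the CPB words correspond to pairs of charge-balanced words
  over the alphabets of sizes 2 and \<open>m\<close>. By a local central limit theorem, the proportion of
  charge-balanced words among the words of even length \<open>n\<close> over the alphabet of size \<open>k\<close> is
  asymptotic to \<open>sqrt (6 / (pi n (k\<^sup>2 - 1)))\<close>: it is a Fourier integral of the \<open>n\<close>-th power of the
  characteristic function, which after rescaling by \<open>sqrt n\<close> converges dominatedly to a Gaussian
  integral. Multiplying the asymptotics for \<open>k = 2\<close> and \<open>k = m\<close> gives the claim.\<close>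

section \<open>Words with a given charge\<close>

definition charge_words :: "nat \<Rightarrow> nat \<Rightarrow> int \<Rightarrow> int list set" where
  "charge_words n q s = {xs \<in> words n q. sum_list xs = s}"

lemma finite_alphabet [simp]: "finite (alphabet q)"
  by (simp add: alphabet_def)

lemma sum_alphabet: "(\<Sum>x\<in>alphabet q. f x) = (\<Sum>k<q. f (2 * int k - int q + 1))"
  unfolding alphabet_def by (subst sum.reindex) (auto simp: inj_on_def)

lemma card_alphabet: "card (alphabet q) = q"
  using sum_alphabet[of "\<lambda>_. 1 :: nat" q] by simp

text \<open>Reversing the index, \<open>k\<close> to \<open>q - 1 - k\<close>, negates a letter. One
  inclusion suffices, since negation is an involution.\<close>

lemma alphabet_uminus: "uminus ` alphabet q = alphabet q"
proof -
  have "uminus ` alphabet q \<subseteq> alphabet q" for q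
  proof clarsimp
    fix x assume "x \<in> alphabet q"
    then obtain k where "k < q" "x = 2 * int k - int q + 1" by (auto simp: alphabet_def)
    then show "- x \<in> alphabet q"
      unfolding alphabet_def by (intro image_eqI[of _ _ "q - 1 - k"]) auto
  qed
  from this[of q] image_mono[OF this[of q], of uminus] show ?thesis
    by (auto simp: image_image)
qed

text \<open>Size and parity replace the index, so that later membership goals need no
  witness.\<close>

lemma alphabet_iff:
  "x \<in> alphabet q \<longleftrightarrow> \<bar>x\<bar> < int q \<and> (even x \<longleftrightarrow> odd q)"
proof
  assume "x \<in> alphabet q"
  then show "\<bar>x\<bar> < int q \<and> (even x \<longleftrightarrow> odd q)" by (auto simp: alphabet_def)
next
  assume *: "\<bar>x\<bar> < int q \<and> (even x \<longleftrightarrow> odd q)"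
  then have "even (x + int q - 1)" by auto
  then obtain j where j: "x + int q - 1 = 2 * j" by (elim evenE)
  with * show "x \<in> alphabet q"
    unfolding alphabet_def by (intro image_eqI[of _ _ "nat j"]) auto
qed

lemma finite_words [simp]: "finite (words n q)"
proof -
  have "words n q = {xs. set xs \<subseteq> alphabet q \<and> length xs = n}" by (auto simp: words_def)
  then show ?thesis by (simp add: finite_lists_length_eq)
qed

lemma finite_charge_words [simp]: "finite (charge_words n q s)"
  by (simp add: charge_words_def)

lemma charge_words_0: "charge_words 0 q s = (if s = 0 then {[]} else {})"
  by (auto simp: charge_words_def words_def)

lemma card_charge_words_Suc:
  "card (charge_words (Suc n) q s) = (\<Sum>x\<in>alphabet q. card (charge_words n q (s - x)))"
proof -
  have "charge_words (Suc n) q s = (\<Union>x\<in>alphabet q. Cons x ` charge_words n q (s - x))"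
  proof (intro set_eqI iffI)
    fix xs assume "xs \<in> charge_words (Suc n) q s"
    then show "xs \<in> (\<Union>x\<in>alphabet q. Cons x ` charge_words n q (s - x))"
      by (cases xs) (auto simp: charge_words_def words_def intro!: bexI[of _ "hd xs"])
  qed (auto simp: charge_words_def words_def)
  also have "card \<dots> = (\<Sum>x\<in>alphabet q. card (Cons x ` charge_words n q (s - x)))"
    by (intro card_UN_disjoint) auto
  also have "\<dots> = (\<Sum>x\<in>alphabet q. card (charge_words n q (s - x)))"
    by (intro sum.cong refl card_image) auto
  finally show ?thesis .
qed

text \<open>Pairs of the opposite extreme letters \<open>q - 1\<close> and \<open>1 - q\<close>
  build a word of charge 0.\<close>

lemma card_charge_words_pos:
  assumes "q > 0" "even n"
  shows "card (charge_words n q 0) > 0"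
proof -
  have "charge_words (2 * k) q 0 \<noteq> {}" for k
  proof (induction k)
    case 0
    show ?case by (simp add: charge_words_0)
  next
    case (Suc k)
    then obtain xs where "xs \<in> charge_words (2 * k) q 0" by auto
    then have "(int q - 1) # (1 - int q) # xs \<in> charge_words (2 * Suc k) q 0"
      using assms(1) by (auto simp: charge_words_def words_def alphabet_iff)
    then show ?case by blast
  qed
  then show ?thesis using assms(2) by (auto simp: card_gt_0_iff elim!: evenE)
qed

section \<open>Separating polarity and magnitude\<close>

text \<open>Turns polarity balance into a linear condition of the same kind as charge
  balance.\<close>

lemma sum_list_sgn:
  "sum_list (map sgn xs) = int (card {i. i < length xs \<and> xs ! i > 0})
     - int (card {i. i < length xs \<and> xs ! i < (0::int)})"
proof -
  have "sum_list (map sgn xs) = (\<Sum>i<length xs. sgn (xs ! i))"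
    by (simp add: sum_list_sum_nth atLeast0LessThan)
  also have "\<dots> = (\<Sum>i<length xs. (if xs ! i > 0 then 1 else 0) - (if xs ! i < 0 then 1 else 0))"
    by (intro sum.cong) (auto simp: sgn_if)
  also have "\<dots> = int (card {i. i < length xs \<and> xs ! i > 0})
     - int (card {i. i < length xs \<and> xs ! i < (0::int)})"
    by (simp add: sum_subtractf sum.If_cases Int_def)
  finally show ?thesis .
qed

lemma cpb_iff: "cpb xs \<longleftrightarrow> sum_list xs = 0 \<and> sum_list (map sgn xs) = 0"
  unfolding cpb_def charge_balanced_def polarity_balanced_def sum_list_sgn
  by (auto simp: sum_list_sum_nth atLeast0LessThan)

lemma sum_list_remove_polarity:
  "sum_list (map (\<lambda>x. x - m * sgn x) xs) = sum_list xs - m * sum_list (map sgn (xs :: int list))"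
  by (induction xs) (auto simp: algebra_simps)

lemma sum_list_map2_affine:
  "length es = length ys \<Longrightarrow>
     sum_list (map2 (\<lambda>e y. m * e + y) es ys) = m * sum_list es + sum_list (ys :: int list)"
  by (induction es ys rule: list_induct2) (auto simp: algebra_simps)

lemma alphabet_2: "alphabet 2 = {-1, 1}"
  by (auto simp: alphabet_def lessThan_nat_numeral numeral_2_eq_2 lessThan_Suc)

text \<open>Since \<open>y\<close> is smaller than \<open>m\<close> in absolute value,
  \<open>m * e\<close> decides the sign; \<open>m\<close> and \<open>y\<close> have opposite parity,
  so the result is odd.\<close>

lemma polarity_magnitude:
  assumes "e \<in> alphabet 2" "y \<in> alphabet m"
  shows "int m * e + y \<in> alphabet (2 * m)" "sgn (int m * e + y) = e"
  using assms by (auto simp: alphabet_2 alphabet_iff sgn_if)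

text \<open>Letters of an alphabet of even size are odd, so their sign is never 0; removing
  \<open>m\<close> times the sign shifts each half of the alphabet onto the alphabet of size
  \<open>m\<close>.\<close>

lemma magnitude_polarity:
  assumes "x \<in> alphabet (2 * m)"
  shows "x - int m * sgn x \<in> alphabet m" "sgn x \<in> alphabet 2"
  using assms by (auto simp: alphabet_2 alphabet_iff sgn_if)

lemma map2_affine_mem:
  assumes "length es = length ys" "set es \<subseteq> alphabet 2" "set ys \<subseteq> alphabet m"
  shows "set (map2 (\<lambda>e y. int m * e + y) es ys) \<subseteq> alphabet (2 * m) \<and>
     map sgn (map2 (\<lambda>e y. int m * e + y) es ys) = es \<and>
     map (\<lambda>x. x - int m * sgn x) (map2 (\<lambda>e y. int m * e + y) es ys) = ys"
  using assms by (induction es ys rule: list_induct2) (auto simp: polarity_magnitude)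

lemma M_CPB_double:
  "M_CPB n (2 * m) = card (charge_words n 2 0) * card (charge_words n m 0)"
proof -
  define f where "f = (\<lambda>xs. (map sgn xs, map (\<lambda>x. x - int m * sgn x) xs))"
  define g where "g = (\<lambda>(es, ys). map2 (\<lambda>e y. int m * e + y) es ys)"
  have gf: "g (f xs) = xs" for xs
    unfolding f_def g_def by (simp add: map2_map_map)
  \<comment> \<open>Once the signs sum to 0, removing \<open>m\<close> times the signs leaves the
    charge unchanged, so the two balance conditions separate into one for each component.\<close>
  have "bij_betw f {xs \<in> words n (2 * m). cpb xs} (charge_words n 2 0 \<times> charge_words n m 0)"
  proof (rule bij_betw_byWitness[where f' = g])
    show "\<forall>xs\<in>{xs \<in> words n (2 * m). cpb xs}. g (f xs) = xs" using gf by simp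
    show "\<forall>p\<in>charge_words n 2 0 \<times> charge_words n m 0. f (g p) = p"
      using map2_affine_mem by (auto simp: charge_words_def words_def f_def g_def)
    show "f ` {xs \<in> words n (2 * m). cpb xs} \<subseteq> charge_words n 2 0 \<times> charge_words n m 0"
      using magnitude_polarity[of _ m]
      by (auto simp: charge_words_def words_def f_def cpb_iff sum_list_remove_polarity subset_iff)
    show "g ` (charge_words n 2 0 \<times> charge_words n m 0) \<subseteq> {xs \<in> words n (2 * m). cpb xs}"
    proof clarify
      fix es ys assume "es \<in> charge_words n 2 0" "ys \<in> charge_words n m 0"
      then show "g (es, ys) \<in> words n (2 * m) \<and> cpb (g (es, ys))"
        using map2_affine_mem[of es ys m] sum_list_map2_affine[of es ys "int m"]
        by (simp add: charge_words_def words_def g_def cpb_iff)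
    qed
  qed
  then show ?thesis
    unfolding M_CPB_def by (simp add: bij_betw_same_card card_cartesian_product)
qed

section \<open>The local limit theorem for the charge\<close>

text \<open>The characteristic function of a uniformly random letter; it is real because the
  alphabet is symmetric.\<close>

definition char_alphabet :: "nat \<Rightarrow> real \<Rightarrow> real" where
  "char_alphabet q t = (\<Sum>x\<in>alphabet q. cos (of_int x * t)) / real q"

section \<open>Fourier inversion for the word counts\<close>

lemma sum_alphabet_sin: "(\<Sum>x\<in>alphabet q. sin (of_int x * t)) = (0 :: real)"
proof -
  have "(\<Sum>x\<in>alphabet q. sin (of_int x * t)) = (\<Sum>x\<in>uminus ` alphabet q. sin (of_int x * t))"
    by (simp add: alphabet_uminus)
  also have "\<dots> = - (\<Sum>x\<in>alphabet q. sin (of_int x * t))"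
    by (subst sum.reindex) (auto simp: sum_negf)
  finally show ?thesis by simp
qed

text \<open>In the addition formula the sine terms cancel by symmetry. This identity drives the
  induction step of Fourier inversion.\<close>

lemma sum_alphabet_cos_mult:
  "(\<Sum>x\<in>alphabet q. cos (of_int x * t)) * cos (of_int s * t) =
     (\<Sum>x\<in>alphabet q. cos (of_int (s - x) * t :: real))"
proof -
  have "(\<Sum>x\<in>alphabet q. cos (of_int (s - x) * t)) =
     (\<Sum>x\<in>alphabet q. cos (of_int x * t) * cos (of_int s * t) + sin (of_int x * t) * sin (of_int s * t))"
    by (intro sum.cong) (auto simp: algebra_simps cos_diff)
  also have "\<dots> = (\<Sum>x\<in>alphabet q. cos (of_int x * t)) * cos (of_int s * t)"
    by (simp add: sum.distrib sum_distrib_right[symmetric] sum_alphabet_sin)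
  finally show ?thesis by simp
qed

lemma has_integral_cos_even:
  assumes "even s"
  shows "((\<lambda>t. cos (of_int s * t)) has_integral (if s = 0 then pi else 0)) {-pi/2..pi/2}"
proof (cases "s = 0")
  case True
  then show ?thesis using has_integral_const_real[of "1::real" "-pi/2" "pi/2"] by simp
next
  case False
  obtain j where j: "s = 2 * j" using assms by (elim evenE)
  have "((\<lambda>t. cos (of_int s * t)) has_integral
      (sin (of_int s * (pi/2)) / of_int s - sin (of_int s * (-pi/2)) / of_int s)) {-pi/2..pi/2}"
    using False
    by (intro fundamental_theorem_of_calculus)
       (auto intro!: derivative_eq_intros simp flip: has_real_derivative_iff_has_vector_derivative)
  moreover have "sin (of_int s * (pi/2)) = 0"
    by (simp add: j sin_zero_iff_int2)
  ultimately show ?thesis using False by simp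
qed

text \<open>The sum of a word of length \<open>n\<close> has the parity of $n(q-1)$; for charges of that parity the
  frequencies that occur are even, so that an interval of length \<open>pi\<close> suffices for Fourier
  inversion. On this interval the characteristic function has modulus 1 at the origin only.\<close>

lemma has_integral_charge_words:
  assumes "even (s - int n * (int q - 1))"
  shows "((\<lambda>t. (\<Sum>x\<in>alphabet q. cos (of_int x * t)) ^ n * cos (of_int s * t)) has_integral
            pi * real (card (charge_words n q s))) {-pi/2..pi/2}"
  using assms
proof (induction n arbitrary: s)
  case 0
  then show ?case using has_integral_cos_even[of s] by (auto simp: charge_words_0)
next
  case (Suc n)
  let ?P = "\<lambda>t. \<Sum>x\<in>alphabet q. cos (of_int x * t :: real)"
  have "((\<lambda>t. \<Sum>x\<in>alphabet q. ?P t ^ n * cos (of_int (s - x) * t)) has_integral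
          (\<Sum>x\<in>alphabet q. pi * real (card (charge_words n q (s - x))))) {-pi/2..pi/2}"
  proof (intro has_integral_sum Suc.IH)
    \<comment> \<open>Every letter has the parity of \<open>q - 1\<close>, so splitting off one
      letter preserves the parity condition.\<close>
    fix x assume "x \<in> alphabet q"
    then have "even (x - (int q - 1))" by (auto simp: alphabet_iff)
    moreover have "s - x - int n * (int q - 1)
        = (s - int (Suc n) * (int q - 1)) - (x - (int q - 1))"
      by (simp add: algebra_simps)
    ultimately show "even (s - x - int n * (int q - 1))"
      using Suc.prems by (metis dvd_diff)
  qed auto
  moreover have "(\<Sum>x\<in>alphabet q. ?P t ^ n * cos (of_int (s - x) * t))
      = ?P t ^ Suc n * cos (of_int s * t)" for t
    by (simp only: sum_distrib_left[symmetric] sum_alphabet_cos_mult[symmetric]) (simp add: mult_ac)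
  ultimately show ?case
    by (simp add: card_charge_words_Suc sum_distrib_left)
qed

section \<open>Gaussian bound on the characteristic function\<close>

lemma one_minus_cos_ge:
  assumes "\<bar>t\<bar> \<le> pi/2"
  shows "1 - cos t \<ge> t\<^sup>2 / 8"
proof -
  \<comment> \<open>By the half angle, \<open>1 - cos t\<close> is
    \<open>2 * (sin x)\<^sup>2\<close>; it then suffices that \<open>sin x \<ge> x / 2\<close>,
    which the cubic Taylor bound gives on the unit interval.\<close>
  define x where "x = \<bar>t\<bar> / 2"
  have x: "0 \<le> x" "x \<le> 1" using assms pi_less_4 by (auto simp: x_def)
  have "\<bar>sin x - x\<bar> \<le> \<bar>x\<bar> ^ 3 / 6"
    using Maclaurin_sin_bound[of x 3] by (simp add: eval_nat_numeral sin_coeff_def)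
  also have "\<bar>x\<bar> ^ 3 = x * x\<^sup>2" using x by (simp add: eval_nat_numeral)
  finally have "sin x \<ge> x - x * x\<^sup>2 / 6" by linarith
  moreover have "x * x\<^sup>2 \<le> x * 1" using x by (intro mult_left_mono) (auto simp: power_le_one)
  ultimately have "sin x \<ge> x / 2" using x by simp
  then have "(x / 2)\<^sup>2 \<le> (sin x)\<^sup>2" using x by (intro power_mono) auto
  moreover have "cos t = 1 - 2 * (sin x)\<^sup>2"
    using cos_double_sin[of x] by (simp add: x_def)
  ultimately show ?thesis by (simp add: x_def power2_eq_square)
qed

text \<open>The two largest letters \<open>q - 3\<close> and \<open>q - 1\<close> alone yield the
  decay: their cosines add up to \<open>2 * cos ((q - 2) * t) * cos t\<close>, at most
  \<open>2 * cos t\<close> in modulus as \<open>cos t \<ge> 0\<close> here. The other cosines are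
  bounded by 1.\<close>

lemma abs_char_alphabet_le:
  assumes "q \<ge> 2" "\<bar>t\<bar> \<le> pi/2"
  shows "\<bar>char_alphabet q t\<bar> \<le> exp (- (t\<^sup>2 / (4 * real q)))"
proof -
  obtain p where p: "q = Suc (Suc p)" using assms(1) by (metis add_2_eq_Suc le_Suc_ex)
  let ?c = "\<lambda>k. cos (of_int (2 * int k - int q + 1) * t)"
  have "?c p + ?c (Suc p) = 2 * cos (real p * t) * cos t"
    by (simp add: p algebra_simps cos_add cos_diff)
  moreover have "\<bar>cos (real p * t) * cos t\<bar> \<le> cos t"
    using assms(2) cos_ge_zero[of t] by (auto simp: abs_mult intro!: mult_left_le_one_le)
  ultimately have "\<bar>?c p + ?c (Suc p)\<bar> \<le> 2 * cos t" by simp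
  moreover have "\<bar>\<Sum>k<p. ?c k\<bar> \<le> real p"
    using sum_norm_bound[of "{..<p}" ?c 1] by simp
  moreover have "(\<Sum>k<q. ?c k) = (\<Sum>k<p. ?c k) + (?c p + ?c (Suc p))"
    by (subst p) (simp only: sum.lessThan_Suc add.assoc)
  ultimately have "\<bar>\<Sum>k<q. ?c k\<bar> \<le> real p + 2 * cos t" by linarith
  also have "\<dots> = real q - 2 * (1 - cos t)" by (simp add: p)
  also have "\<dots> \<le> real q - t\<^sup>2 / 4" using one_minus_cos_ge[OF assms(2)] by simp
  finally have "\<bar>char_alphabet q t\<bar> \<le> (real q - t\<^sup>2 / 4) / real q"
    using assms(1) unfolding char_alphabet_def sum_alphabet
    by (simp add: abs_divide divide_right_mono)
  also have "\<dots> = 1 + - (t\<^sup>2 / (4 * real q))" using assms(1) by (simp add: field_simps)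
  also have "\<dots> \<le> exp (- (t\<^sup>2 / (4 * real q)))" by (rule exp_ge_add_one_self)
  finally show ?thesis .
qed

section \<open>Pointwise limit of the rescaled powers\<close>

lemma tendsto_power_exp:
  fixes a :: "nat \<Rightarrow> real"
  assumes "a \<longlonglongrightarrow> L"
  shows "(\<lambda>n. (1 + a n / real n) ^ n) \<longlonglongrightarrow> exp L"
proof -
  have an: "(\<lambda>n. a n / real n) \<longlonglongrightarrow> 0"
    by (rule tendsto_divide_0[OF assms])
       (simp add: filterlim_at_top_imp_at_infinity filterlim_real_sequentially)
  \<comment> \<open>Below \<open>1/2\<close> the quadratic error bound for \<open>ln (1 + x)\<close>
    applies, and \<open>1 + a n / n\<close> is positive.\<close>
  have ev: "eventually (\<lambda>n. \<bar>a n / real n\<bar> < 1/2 \<and> n > 0) sequentially"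
    by (intro eventually_conj order_tendstoD(2)[OF tendsto_rabs_zero[OF an]] eventually_gt_at_top) simp
  have "(\<lambda>n. real n * ln (1 + a n / real n) - a n) \<longlonglongrightarrow> 0"
  proof (rule Lim_null_comparison)
    show "eventually (\<lambda>n. norm (real n * ln (1 + a n / real n) - a n)
            \<le> 2 * a n * (a n / real n)) sequentially"
      using ev
    proof eventually_elim
      case (elim n)
      then have "\<bar>ln (1 + a n / real n) - a n / real n\<bar> \<le> 2 * (a n / real n)\<^sup>2"
        by (intro abs_ln_one_plus_x_minus_x_bound) auto
      then have "real n * \<bar>ln (1 + a n / real n) - a n / real n\<bar> \<le> real n * (2 * (a n / real n)\<^sup>2)"
        by (intro mult_left_mono) auto
      also have "real n * (2 * (a n / real n)\<^sup>2) = 2 * a n * (a n / real n)"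
        using elim by (simp add: power2_eq_square)
      also have "real n * \<bar>ln (1 + a n / real n) - a n / real n\<bar>
          = \<bar>real n * (ln (1 + a n / real n) - a n / real n)\<bar>"
        by (simp add: abs_mult)
      also have "real n * (ln (1 + a n / real n) - a n / real n)
          = real n * ln (1 + a n / real n) - a n"
        using elim by (simp add: field_simps)
      finally show ?case by simp
    qed
    show "(\<lambda>n. 2 * a n * (a n / real n)) \<longlonglongrightarrow> 0"
      using tendsto_mult[OF tendsto_mult[OF tendsto_const[of 2] assms] an] by simp
  qed
  from tendsto_exp[OF tendsto_add[OF this assms]]
  have "(\<lambda>n. exp (real n * ln (1 + a n / real n))) \<longlonglongrightarrow> exp L" by simp
  then show ?thesis
  proof (rule Lim_transform_eventually)
    show "eventually (\<lambda>n. exp (real n * ln (1 + a n / real n)) = (1 + a n / real n) ^ n) sequentially"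
      using ev
    proof eventually_elim
      case (elim n)
      then have "1 + a n / real n > 0" by linarith
      then show ?case by (simp add: exp_of_nat_mult)
    qed
  qed
qed

text \<open>The shift \<open>c\<close> is independent of \<open>n\<close> so that induction on
  \<open>n\<close> works; only afterwards is it set to \<open>1 - q\<close> with
  \<open>n = q\<close>.\<close>

lemma sum_arith_squares:
  "(\<Sum>k<n. (2 * real k + c)\<^sup>2)
     = real n * (2 * (real n - 1) * (2 * real n - 1) + 6 * c * (real n - 1) + 3 * c\<^sup>2) / 3"
  by (induction n) (auto simp: field_simps power2_eq_square)

lemma sum_alphabet_squares:
  "(\<Sum>x\<in>alphabet q. (real_of_int x)\<^sup>2) = real q * ((real q)\<^sup>2 - 1) / 3"
proof -
  have "(\<Sum>x\<in>alphabet q. (real_of_int x)\<^sup>2) = (\<Sum>k<q. (2 * real k + (1 - real q))\<^sup>2)"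
    unfolding sum_alphabet by (simp add: algebra_simps)
  then show ?thesis
    unfolding sum_arith_squares by (simp add: power2_eq_square algebra_simps)
qed

text \<open>A random letter has variance \<open>((real q)\<^sup>2 - 1) / 3\<close>, and the
  second-order expansion of the cosines gives the Gaussian limit, as in the central limit
  theorem.\<close>

lemma char_alphabet_power_tendsto:
  assumes "q > 0"
  shows "(\<lambda>n. char_alphabet q (s / sqrt (real n)) ^ n)
            \<longlonglongrightarrow> exp (- (((real q)\<^sup>2 - 1) / 6 * s\<^sup>2))"
proof -
  \<comment> \<open>Chosen so that, for \<open>n > 0\<close>, \<open>1 + a n / n\<close> is the
    characteristic function at \<open>s / sqrt n\<close>.\<close>
  define a where "a n = (\<Sum>x\<in>alphabet q. real n * (cos (of_int x * (s / sqrt (real n))) - 1)) / real q" for n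
  have lim: "(\<lambda>n. real n * (cos (c * (s / sqrt (real n))) - 1)) \<longlonglongrightarrow> - (c\<^sup>2 * s\<^sup>2 / 2)" for c :: real
  proof -
    have "(\<lambda>n. real n * (cos (d / sqrt (real n)) - 1)) \<longlonglongrightarrow> - (d * d / 2)" for d :: real
      by real_asymp
    from this[of "c * s"] show ?thesis by (simp add: power2_eq_square mult_ac)
  qed
  have "a \<longlonglongrightarrow> (\<Sum>x\<in>alphabet q. - ((of_int x)\<^sup>2 * s\<^sup>2 / 2)) / real q"
    unfolding a_def using assms by (intro tendsto_intros lim) auto
  also have "(\<Sum>x\<in>alphabet q. - ((of_int x)\<^sup>2 * s\<^sup>2 / 2)) / real q
      = - ((\<Sum>x\<in>alphabet q. (real_of_int x)\<^sup>2) * s\<^sup>2 / (2 * real q))"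
    by (simp add: sum_negf sum_distrib_right sum_divide_distrib)
  also have "\<dots> = - (((real q)\<^sup>2 - 1) / 6 * s\<^sup>2)"
    using assms by (simp add: sum_alphabet_squares field_simps)
  finally have "(\<lambda>n. (1 + a n / real n) ^ n) \<longlonglongrightarrow> exp (- (((real q)\<^sup>2 - 1) / 6 * s\<^sup>2))"
    by (rule tendsto_power_exp)
  moreover have "(1 + a n / real n) ^ n = char_alphabet q (s / sqrt (real n)) ^ n" for n
  proof (cases "n = 0")
    case False
    have "a n = real n * (char_alphabet q (s / sqrt (real n)) - 1)"
      using assms unfolding a_def char_alphabet_def
      by (simp add: sum_distrib_left[symmetric] sum_subtractf card_alphabet field_simps)
    then show ?thesis using False by simp
  qed simp
  ultimately show ?thesis by simp
qed

section \<open>Convergence of the rescaled Fourier integrals\<close>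

lemma gaussian_lborel:
  assumes "c > 0"
  shows "integrable lborel (\<lambda>s. exp (- (c * s\<^sup>2)))"
    and "integral\<^sup>L lborel (\<lambda>s. exp (- (c * s\<^sup>2))) = sqrt (pi / c)"
proof -
  \<comment> \<open>The standard deviation for which the normal density has exponent
    \<open>- (c * s\<^sup>2)\<close>.\<close>
  define \<sigma> where "\<sigma> = sqrt (1 / (2 * c))"
  have \<sigma>: "\<sigma> > 0" "\<sigma>\<^sup>2 = 1 / (2 * c)" using assms by (auto simp: \<sigma>_def)
  have eq: "(\<lambda>s. exp (- (c * s\<^sup>2))) = (\<lambda>s. sqrt (pi / c) * normal_density 0 \<sigma> s)"
    using assms by (auto simp: normal_density_def \<sigma> real_sqrt_divide field_simps)
  show "integrable lborel (\<lambda>s. exp (- (c * s\<^sup>2)))"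
    unfolding eq using \<sigma> by (intro integrable_mult_right integrable_normal_density)
  show "integral\<^sup>L lborel (\<lambda>s. exp (- (c * s\<^sup>2))) = sqrt (pi / c)"
    unfolding eq using \<sigma> by simp
qed

lemma isCont_char_alphabet [continuous_intros]: "isCont (char_alphabet q) t"
  unfolding char_alphabet_def by (cases "q = 0") (auto intro!: continuous_intros)

lemma borel_measurable_char_alphabet [measurable]: "char_alphabet q \<in> borel_measurable borel"
  by (intro borel_measurable_continuous_onI continuous_at_imp_continuous_on)
     (auto intro: isCont_char_alphabet)

lemma integral_char_alphabet_power_tendsto:
  assumes "q \<ge> 2"
  shows "(\<lambda>n. sqrt (real n) * integral {-pi/2..pi/2} (\<lambda>t. char_alphabet q t ^ n))
           \<longlonglongrightarrow> sqrt (6 * pi / ((real q)\<^sup>2 - 1))"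
proof -
  \<comment> \<open>The indicator extends the integrand to the whole line, so that the substitution
    \<open>t = s / sqrt n\<close> involves no moving endpoints.\<close>
  define F where "F n t = char_alphabet q t ^ n * indicator {-pi/2..pi/2} t" for n :: nat and t
  have [measurable]: "F n \<in> borel_measurable borel" for n unfolding F_def by measurable
  have "(real q)\<^sup>2 > 1" using assms by (intro one_less_power) auto
  then have v: "((real q)\<^sup>2 - 1) / 6 > 0" by simp
  have F: "integral {-pi/2..pi/2} (\<lambda>t. char_alphabet q t ^ n) = integral\<^sup>L lborel (F n)" for n
  proof -
    have "set_integrable lborel {-pi/2..pi/2} (\<lambda>t. char_alphabet q t ^ n)"
      by (intro borel_integrable_atLeastAtMost' continuous_at_imp_continuous_on)
         (auto intro!: continuous_intros)
    from set_borel_integral_eq_integral(2)[OF this] show ?thesis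
      by (simp add: set_lebesgue_integral_def F_def mult.commute[of "indicator _ _"] cong: Bochner_Integration.integral_cong)
  qed
  \<comment> \<open>The index \<open>Suc n\<close> excludes 0, where division by zero would make the
    integrand constantly 1 and break the domination.\<close>
  have lim: "(\<lambda>n. integral\<^sup>L lborel (\<lambda>s. F (Suc n) (s / sqrt (real (Suc n)))))
      \<longlonglongrightarrow> integral\<^sup>L lborel (\<lambda>s. exp (- (((real q)\<^sup>2 - 1) / 6 * s\<^sup>2)))"
  proof (rule integral_dominated_convergence[where w = "\<lambda>s. exp (- (1 / (4 * real q) * s\<^sup>2))"])
    show "integrable lborel (\<lambda>s. exp (- (1 / (4 * real q) * s\<^sup>2)))"
      using assms by (intro gaussian_lborel) auto
    show "AE s in lborel. (\<lambda>n. F (Suc n) (s / sqrt (real (Suc n)))) \<longlonglongrightarrow> exp (- (((real q)\<^sup>2 - 1) / 6 * s\<^sup>2))"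
    proof (rule AE_I2)
      fix s :: real
      \<comment> \<open>For fixed \<open>s\<close> the rescaled argument eventually lies in the
        interval, so the cutoff disappears in the limit.\<close>
      have "(\<lambda>n. s / sqrt (real n)) \<longlonglongrightarrow> 0" by real_asymp
      from tendsto_rabs_zero[OF this]
      have "eventually (\<lambda>n. \<bar>s / sqrt (real n)\<bar> < pi/2) sequentially"
        by (rule order_tendstoD(2)) simp
      then have "eventually (\<lambda>n. char_alphabet q (s / sqrt (real n)) ^ n = F n (s / sqrt (real n))) sequentially"
      proof eventually_elim
        case (elim n)
        then have "s / sqrt (real n) \<in> {-pi/2..pi/2}" unfolding atLeastAtMost_iff by linarith
        then show ?case by (simp only: F_def indicator_simps mult_1_right)
      qed
      then have "(\<lambda>n. F n (s / sqrt (real n))) \<longlonglongrightarrow> exp (- (((real q)\<^sup>2 - 1) / 6 * s\<^sup>2))"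
        using char_alphabet_power_tendsto[of q s] assms by (auto intro: Lim_transform_eventually)
      then show "(\<lambda>n. F (Suc n) (s / sqrt (real (Suc n))))
          \<longlonglongrightarrow> exp (- (((real q)\<^sup>2 - 1) / 6 * s\<^sup>2))"
        by (rule LIMSEQ_Suc)
    qed
    fix n :: nat
    show "AE s in lborel. norm (F (Suc n) (s / sqrt (real (Suc n)))) \<le> exp (- (1 / (4 * real q) * s\<^sup>2))"
    proof (rule AE_I2)
      fix s :: real
      define t where "t = s / sqrt (real (Suc n))"
      \<comment> \<open>The power \<open>Suc n\<close> multiplies the exponent of the bound at
        \<open>t\<close> by \<open>Suc n\<close>, which makes it a Gaussian in \<open>s\<close>
        independent of \<open>n\<close>.\<close>
      have t: "t\<^sup>2 * real (Suc n) = s\<^sup>2"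
        unfolding t_def by (simp add: power_divide del: of_nat_Suc)
      show "norm (F (Suc n) (s / sqrt (real (Suc n)))) \<le> exp (- (1 / (4 * real q) * s\<^sup>2))"
        unfolding t_def[symmetric]
      proof (cases "t \<in> {-pi/2..pi/2}")
        case True
        then have "\<bar>t\<bar> \<le> pi/2" unfolding atLeastAtMost_iff by linarith
        then have "\<bar>char_alphabet q t\<bar> ^ Suc n \<le> exp (- (t\<^sup>2 / (4 * real q))) ^ Suc n"
          using assms by (intro power_mono abs_char_alphabet_le) auto
        also have "\<dots> = exp (- (1 / (4 * real q) * s\<^sup>2))"
          unfolding exp_of_nat_mult[symmetric] t[symmetric] by simp
        finally show "norm (F (Suc n) t) \<le> exp (- (1 / (4 * real q) * s\<^sup>2))"
          using True by (simp only: F_def indicator_simps mult_1_right real_norm_def power_abs)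
      next
        case False
        then show "norm (F (Suc n) t) \<le> exp (- (1 / (4 * real q) * s\<^sup>2))"
          by (simp only: F_def indicator_simps) simp
      qed
    qed
  qed auto
  moreover have "integral\<^sup>L lborel (\<lambda>s. F (Suc n) (s / sqrt (real (Suc n))))
      = sqrt (real (Suc n)) * integral\<^sup>L lborel (F (Suc n))" for n
    using lborel_integral_real_affine[of "1 / sqrt (real (Suc n))" "F (Suc n)" 0]
    by (simp add: field_simps del: of_nat_Suc)
  ultimately have "(\<lambda>n. sqrt (real (Suc n)) * integral\<^sup>L lborel (F (Suc n)))
      \<longlonglongrightarrow> sqrt (pi / (((real q)\<^sup>2 - 1) / 6))"
    by (simp only: gaussian_lborel(2)[OF v])
  from LIMSEQ_imp_Suc[OF this] show ?thesis unfolding F by (simp add: mult.commute)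
qed

lemma card_charge_words_0_eq:
  assumes "even n" "q > 0"
  shows "real (card (charge_words n q 0)) / real q ^ n
     = integral {-pi/2..pi/2} (\<lambda>t. char_alphabet q t ^ n) / pi"
proof -
  have "((\<lambda>t. (\<Sum>x\<in>alphabet q. cos (of_int x * t)) ^ n / real q ^ n) has_integral
            pi * real (card (charge_words n q 0)) / real q ^ n) {-pi/2..pi/2}"
    using has_integral_divide[OF has_integral_charge_words[of 0 n q]] assms by simp
  then have "((\<lambda>t. char_alphabet q t ^ n) has_integral
            pi * real (card (charge_words n q 0)) / real q ^ n) {-pi/2..pi/2}"
    by (simp add: char_alphabet_def power_divide)
  from integral_unique[OF this] show ?thesis by simp
qed

text \<open>The integrals converge along all \<open>n\<close>, but their link to the word count is
  available for even \<open>n\<close>, hence the restricted filter.\<close>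

lemma card_charge_words_0_asymp:
  assumes "q \<ge> 2"
  shows "((\<lambda>n. sqrt (real n) * (real (card (charge_words n q 0)) / real q ^ n))
           \<longlongrightarrow> sqrt (6 / (pi * ((real q)\<^sup>2 - 1)))) (inf sequentially (principal {n. even n}))"
proof -
  have "(\<lambda>n. sqrt (real n) * integral {-pi/2..pi/2} (\<lambda>t. char_alphabet q t ^ n) / pi)
           \<longlonglongrightarrow> sqrt (6 * pi / ((real q)\<^sup>2 - 1)) / pi"
    by (intro tendsto_divide integral_char_alphabet_power_tendsto assms tendsto_const) auto
  also have "sqrt (6 * pi / ((real q)\<^sup>2 - 1)) / pi = sqrt (6 * pi / ((real q)\<^sup>2 - 1) / pi\<^sup>2)"
    by (subst real_sqrt_divide[of _ "pi\<^sup>2"]) simp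
  also have "\<dots> = sqrt (6 / (pi * ((real q)\<^sup>2 - 1)))"
    by (simp add: power2_eq_square)
  finally have "((\<lambda>n. sqrt (real n) * integral {-pi/2..pi/2} (\<lambda>t. char_alphabet q t ^ n) / pi)
      \<longlongrightarrow> sqrt (6 / (pi * ((real q)\<^sup>2 - 1)))) (inf sequentially (principal {n. even n}))"
    by (rule tendsto_mono[OF inf_le1])
  then show ?thesis
    by (rule Lim_transform_eventually)
       (use assms in \<open>simp only: eventually_inf_principal mem_Collect_eq,
         intro always_eventually allI impI, simp only: card_charge_words_0_eq, simp\<close>)
qed

section \<open>Redundancy\<close>

text \<open>Redundancy decreases with the size of a code, so the set of all CPB words attains the
  minimum.\<close>

lemma r_CPB_eq:
  assumes "q \<ge> 2" "M_CPB n q > 0"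
  shows "r_CPB n q = real n - log (real q) (real (M_CPB n q))"
proof -
  let ?A = "{xs \<in> words n q. cpb xs}"
  let ?R = "{redundancy n q C | C. cpb_code n q C \<and> C \<noteq> {}}"
  have codes: "cpb_code n q C \<longleftrightarrow> C \<subseteq> ?A" for C by (auto simp: cpb_code_def)
  have "finite ?A" by simp
  moreover have "?R \<subseteq> redundancy n q ` Pow ?A" by (auto simp: codes)
  ultimately have "finite ?R" by (meson finite_Pow_iff finite_imageI finite_subset)
  moreover have "real n - log (real q) (real (M_CPB n q)) \<in> ?R"
    using assms(2) unfolding M_CPB_def redundancy_def codes
    by (intro CollectI exI[of _ ?A]) (auto simp: card_gt_0_iff)
  moreover have "real n - log (real q) (real (M_CPB n q)) \<le> r" if "r \<in> ?R" for r
  proof -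
    obtain C where C: "r = redundancy n q C" "C \<subseteq> ?A" "C \<noteq> {}" using \<open>r \<in> ?R\<close> unfolding codes by blast
    then have "card C \<le> M_CPB n q" "0 < card C"
      unfolding M_CPB_def using \<open>finite ?A\<close> by (auto simp: card_gt_0_iff intro: card_mono finite_subset)
    then show ?thesis using C(1) assms(1) by (simp add: redundancy_def)
  qed
  ultimately show ?thesis unfolding r_CPB_def by (intro Min_eqI)
qed

text \<open>The two word counts contribute a factor \<open>sqrt n\<close> each. With
  \<open>q = 2 * m\<close> one has \<open>m^2 - 1 = (q^2 - 4) / 4\<close>, which turns
  \<open>36 / (3 * (m^2 - 1))\<close> into \<open>48 / (q^2 - 4)\<close>.\<close>

lemma M_CPB_asymp:
  assumes "q \<ge> 4" "even q"
  shows "((\<lambda>n. real n * real (M_CPB n q) / real q ^ n)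
           \<longlongrightarrow> 1 / (pi * sqrt (((real q)\<^sup>2 - 4) / 48))) (inf sequentially (principal {n. even n}))"
proof -
  obtain m where m: "q = 2 * m" using assms(2) by (elim evenE)
  have m2: "m \<ge> 2" using assms(1) m by simp
  have "sqrt (6 / (pi * ((real 2)\<^sup>2 - 1))) * sqrt (6 / (pi * ((real m)\<^sup>2 - 1)))
      = sqrt ((1 / pi\<^sup>2) * (48 / ((real q)\<^sup>2 - 4)))"
    unfolding real_sqrt_mult[symmetric]
    by (rule arg_cong[where f = sqrt]) (simp add: m power2_eq_square divide_simps)
  also have "\<dots> = 1 / (pi * sqrt (((real q)\<^sup>2 - 4) / 48))"
    by (simp add: real_sqrt_mult real_sqrt_divide)
  finally have lim: "sqrt (6 / (pi * ((real 2)\<^sup>2 - 1))) * sqrt (6 / (pi * ((real m)\<^sup>2 - 1)))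
      = 1 / (pi * sqrt (((real q)\<^sup>2 - 4) / 48))" .
  have "(sqrt (real n) * (real (card (charge_words n 2 0)) / real 2 ^ n)) *
       (sqrt (real n) * (real (card (charge_words n m 0)) / real m ^ n))
     = real n * real (M_CPB n q) / real q ^ n" for n
  proof -
    have "(sqrt (real n) * (real (card (charge_words n 2 0)) / real 2 ^ n)) *
       (sqrt (real n) * (real (card (charge_words n m 0)) / real m ^ n))
      = (sqrt (real n) * sqrt (real n)) * (real (M_CPB n q) / (2 * real m) ^ n)"
      by (simp add: M_CPB_double m power_mult_distrib)
    then show ?thesis by (simp add: m)
  qed
  with tendsto_mult[OF card_charge_words_0_asymp[of 2] card_charge_words_0_asymp[OF m2]]
  show ?thesis by (simp only: lim order.refl)
qed

theorem corollary10:
  fixes q :: nat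
  assumes "q \<ge> 4" and "even q"
  shows "(\<forall>n. even n \<and> n > 0 \<longrightarrow> r_CPB n q = real n - log (real q) (real (M_CPB n q))) \<and>
         ((\<lambda>n. r_CPB n q
              - (log (real q) (real n) + log (real q) (pi * sqrt (((real q)\<^sup>2 - 4) / 48))))
            \<longlongrightarrow> 0) (inf sequentially (principal {n. even n}))"
proof (intro conjI allI impI)
  have Mpos: "M_CPB n q > 0" if "even n" for n
    using assms that by (auto elim!: evenE simp: M_CPB_double card_charge_words_pos simp del: mult_pos_pos)
  show r: "r_CPB n q = real n - log (real q) (real (M_CPB n q))" if "even n \<and> n > 0" for n
    using assms that by (intro r_CPB_eq Mpos) auto
  let ?F = "inf sequentially (principal {n::nat. even n})"
  define K where "K = pi * sqrt (((real q)\<^sup>2 - 4) / 48)"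
  \<comment> \<open>This keeps the radicand positive, so that the logarithm is continuous at the
    limit \<open>1 / K\<close>.\<close>
  have "(real q)\<^sup>2 \<ge> 4\<^sup>2" using assms(1) by (intro power_mono) auto
  then have K: "K > 0" by (simp add: K_def)
  have "((\<lambda>n. - log (real q) (real n * real (M_CPB n q) / real q ^ n) - log (real q) K)
      \<longlongrightarrow> - log (real q) (1 / K) - log (real q) K) ?F"
    using assms K M_CPB_asymp[OF assms] unfolding K_def[symmetric]
    by (intro tendsto_diff tendsto_minus tendsto_log tendsto_const) auto
  moreover have "- log (real q) (1 / K) - log (real q) K = 0"
    using K by (simp add: log_divide)
  \<comment> \<open>For even \<open>n > 0\<close> all factors are positive, so the logarithm splits,
    and the power \<open>q ^ n\<close> supplies the term \<open>n\<close> of the redundancy.\<close>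
  moreover have "eventually (\<lambda>n. - log (real q) (real n * real (M_CPB n q) / real q ^ n) - log (real q) K
      = r_CPB n q - (log (real q) (real n) + log (real q) K)) ?F"
    unfolding eventually_inf_principal using eventually_gt_at_top[of 0]
  proof eventually_elim
    case (elim n)
    show ?case
      using r[of n] Mpos[of n] elim assms
      by (auto simp: log_divide log_mult log_nat_power)
  qed
  ultimately show "((\<lambda>n. r_CPB n q - (log (real q) (real n) + log (real q) (pi * sqrt (((real q)\<^sup>2 - 4) / 48))))
            \<longlongrightarrow> 0) ?F"
    unfolding K_def[symmetric] by (auto intro: Lim_transform_eventually)
qed

end
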